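(* Let $(X,(f_n))$ be a complex situation such that $f_m(f_n(x))=f_m(x)$ whenever $m<n$ and both $f_m(f_n(x))$ and $f_m(x)$ are defined. Then $(2^\omega,\mathbb{G}_1)\preceq^{inj}_c(X,A^f)$.
   Context: For a sequence $(f_n)$ of partial functions, $A^f:=\bigcup_n\mathrm{Graph}(f_n)$. A complex situation is a pair $(X,(f_n)_{n\in\omega})$ where $X$ is a nonempty Polish space, each $f_n$ is a partial continuous open map on $X$ whose domain and range are open in $X$, and $\Delta(X)\subseteq\overline{A^f}\setminus A^f$ ($\Delta(X)$ the diagonal). $(X,A)\preceq^{inj}_c(Y,B)$ means there is an injective continuous $h:X\to Y$ with $A\subseteq(h\times h)^{-1}(B)$. Let $\psi:\omega\to 2^{<\omega}$ be the bijection enumerating finite binary sequences by length and then lexicographically. Let $q_0=0$, $q_{n+1}=3\cdot 2^{q_n}$, $t_n:=\psi(n)0^{2^{q_n}-|\psi(n)|}$, $S_n:=\{2^{q_n}j:j\ge1\}$, $\theta_n(k)=k$ if $k\notin S_n$ and $\theta_n(2^{q_n}j)=2^{q_n}(2j+1)$ for $j\ge1$. For $s\in2^{<\omega}$, $N_s=\{\alpha\in 2^\omega:s\subseteq\alpha\}$. Define $g_n:N_{t_n0}\to N_{t_n1}$ by $g_n(\alpha)(k)=1$ if $k=2^{q_n}$ and $g_n(\alpha)(k)=\alpha(\theta_n(k))$ otherwise, and $\mathbb{G}_1:=\bigcup_n\mathrm{Graph}(g_n)$. *)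

theory Defs
  imports "HOL-Analysis.Analysis"
begin

text \<open>Partial maps are modelled as total functions f n together with a domain D n.\<close>

definition graph_of :: "'a set \<Rightarrow> ('a \<Rightarrow> 'b) \<Rightarrow> ('a \<times> 'b) set" where
  "graph_of D g = {(x, g x) | x. x \<in> D}"

definition Af :: "(nat \<Rightarrow> 'a set) \<Rightarrow> (nat \<Rightarrow> 'a \<Rightarrow> 'a) \<Rightarrow> ('a \<times> 'a) set" where
  "Af D f = (\<Union>n. graph_of (D n) (f n))"

text \<open>Complex situation on a Polish space (Polishness and nonemptiness come from the type class /
  HOL types being nonempty).\<close>
definition complex_situation :: "(nat \<Rightarrow> 'a::polish_space set) \<Rightarrow> (nat \<Rightarrow> 'a \<Rightarrow> 'a) \<Rightarrow> bool" where
  "complex_situation D f \<longleftrightarrow>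
     (\<forall>n. open (D n) \<and> open (f n ` D n) \<and> continuous_on (D n) (f n)
          \<and> (\<forall>U. open U \<and> U \<subseteq> D n \<longrightarrow> open (f n ` U)))
     \<and> (\<forall>x. (x, x) \<in> closure (Af D f) - Af D f)"

definition cantor_top :: "(nat \<Rightarrow> bool) topology" where
  "cantor_top = product_topology (\<lambda>_. discrete_topology UNIV) UNIV"

text \<open>psi: enumeration of finite binary sequences by length, then lexicographically.
  psi n is the binary expansion of n+1 with the leading 1 removed.\<close>
function psi :: "nat \<Rightarrow> bool list" where
  "psi n = (if n = 0 then [] else psi ((n + 1) div 2 - 1) @ [odd (n + 1)])"
  by auto
termination by (relation "Wellfounded.measure id") auto

fun q :: "nat \<Rightarrow> nat" where
  "q 0 = 0"
| "q (Suc n) = 3 * 2 ^ q n"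

definition t :: "nat \<Rightarrow> bool list" where
  "t n = psi n @ replicate (2 ^ q n - length (psi n)) False"

definition S :: "nat \<Rightarrow> nat set" where
  "S n = {2 ^ q n * j | j. j \<ge> 1}"

definition theta :: "nat \<Rightarrow> nat \<Rightarrow> nat" where
  "theta n k = (if k \<in> S n then 2 ^ q n * (2 * (k div 2 ^ q n) + 1) else k)"

definition Nbhd :: "bool list \<Rightarrow> (nat \<Rightarrow> bool) set" where
  "Nbhd s = {\<alpha>. \<forall>i < length s. \<alpha> i = s ! i}"

definition g :: "nat \<Rightarrow> (nat \<Rightarrow> bool) \<Rightarrow> (nat \<Rightarrow> bool)" where
  "g n \<alpha> = (\<lambda>k. if k = 2 ^ q n then True else \<alpha> (theta n k))"

definition G1 :: "((nat \<Rightarrow> bool) \<times> (nat \<Rightarrow> bool)) set" where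
  "G1 = (\<Union>n. graph_of (Nbhd (t n @ [False])) (g n))"

end

theory Submission
  imports Defs
begin

text \<open>
  Let M be the largest index m < n such that the domain of \<^term>\<open>g m\<close> contains \<alpha>.
  Since g m (g M \<alpha>) = g m \<alpha> for m < M, the edges \<alpha> \<mapsto> g M \<alpha> determine all others with index below n,
  and they form a forest oriented towards its roots. Two sequences are identified at stage n if the
  first \<^term>\<open>q n\<close> digits of all their iterates along the forest agree. This leaves finitely many
  vertices, and the growth of q ensures that \<^term>\<open>Nbhd (t n)\<close> lies in a single class.

  At each stage the vertices of this finite forest are sent to distinct points of X so that forest
  edges go to graphs of the given maps; by the absorption hypothesis the remaining edges follow. Such a
  family can be moved slightly: continuity pushes points towards the root and openness lifts them
  back. To pass to stage n + 1, choose y near the image of \<^term>\<open>t n\<close> whose image under some new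
  map is near it too, and use one perturbed copy of the family through each of these two points.
  Absorption also makes each of the given maps nowhere locally finite-to-one, so that all vertices can be
  made distinct. The embedding is the uniform limit of these families.
\<close>

subsection \<open>The maps g on the Cantor space\<close>

lemma q_mono_Suc: "q n < q (Suc n)"
  by (simp) (metis less_exp mult.commute nat_mult_1_right less_le_trans mult_le_mono2 one_le_numeral)

lemma q_strict_mono: "strict_mono q"
  by (rule strict_monoI_Suc) (rule q_mono_Suc)

lemma le_q: "n \<le> q n"
  by (rule strict_mono_imp_increasing[OF q_strict_mono])

lemma pow_q_less_q:
  assumes "m < n" shows "3 * 2 ^ q m \<le> q n"
proof -
  have "q (Suc m) \<le> q n"
    using assms strict_mono_less_eq[OF q_strict_mono] by (metis Suc_leI)
  then show ?thesis by simp
qed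

declare psi.simps [simp del]

lemma length_psi: "length (psi n) \<le> n"
proof (induction n rule: less_induct)
  case (less n)
  show ?case
  proof (cases "n = 0")
    case False
    then have "(n + 1) div 2 - 1 < n" by simp
    from less.IH[OF this] False show ?thesis
      by (subst psi.simps) simp
  qed (subst psi.simps, simp)
qed

lemma length_t [simp]: "length (t n) = 2 ^ q n"
proof -
  have "length (psi n) \<le> 2 ^ q n"
    using length_psi[of n] le_q[of n] less_exp[of "q n"] by linarith
  then show ?thesis by (simp add: t_def)
qed

definition dom_g :: "nat \<Rightarrow> (nat \<Rightarrow> bool) set" where
  "dom_g n = Nbhd (t n @ [False])"

definition agree :: "nat \<Rightarrow> (nat \<Rightarrow> bool) \<Rightarrow> (nat \<Rightarrow> bool) \<Rightarrow> bool" where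
  "agree L \<alpha> \<beta> \<longleftrightarrow> (\<forall>i<L. \<alpha> i = \<beta> i)"

lemma mem_Nbhd_t: "\<alpha> \<in> Nbhd (t n) \<longleftrightarrow> (\<forall>i<2 ^ q n. \<alpha> i = t n ! i)"
  by (simp add: Nbhd_def)

lemma mem_dom_g: "\<alpha> \<in> dom_g n \<longleftrightarrow> \<alpha> \<in> Nbhd (t n) \<and> \<not> \<alpha> (2 ^ q n)"
  by (auto simp: dom_g_def Nbhd_def nth_append less_Suc_eq)

lemma theta_small: "k < 2 ^ q n \<Longrightarrow> theta n k = k"
  by (auto simp: theta_def S_def)

lemma theta_le: "theta n k \<le> 2 * k + 2 ^ q n"
  by (auto simp: theta_def S_def algebra_simps)

lemma g_small: "k < 2 ^ q n \<Longrightarrow> g n \<alpha> k = \<alpha> k"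
  by (simp add: g_def theta_small)

lemma g_pivot: "g n \<alpha> (2 ^ q n)"
  by (simp add: g_def)

lemma g_mem_Nbhd_t: "\<alpha> \<in> Nbhd (t n) \<Longrightarrow> g n \<alpha> \<in> Nbhd (t n)"
  by (simp add: mem_Nbhd_t g_small)

text \<open>A positive multiple of \<open>2 ^ q n\<close> is an even multiple of
  \<open>2 ^ q m\<close>. The values of \<open>theta m\<close> are odd multiples of
  \<open>2 ^ q m\<close>, non-multiples, or 0, so they avoid \<open>S n\<close>.\<close>

lemma theta_theta:
  assumes "m < n" shows "theta n (theta m k) = theta m k"
proof -
  have dv: "(2::nat) * 2 ^ q m dvd 2 ^ q n"
    using strict_mono_less[OF q_strict_mono, of m n] assms
    by (metis Suc_leI le_imp_power_dvd power_Suc)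
  have "theta m k \<in> S n \<Longrightarrow> False"
  proof -
    assume "theta m k \<in> S n"
    then obtain j where j: "theta m k = 2 ^ q n * j" "j \<ge> 1" by (auto simp: S_def)
    then have d: "2 * 2 ^ q m dvd theta m k" using dv by (simp add: dvd_mult2)
    show False
    proof (cases "k \<in> S m")
      case True
      then have "2 * 2 ^ q m dvd 2 ^ q m * (2 * (k div 2 ^ q m) + 1)"
        using d by (simp add: theta_def)
      then have "2 dvd 2 * (k div 2 ^ q m) + (1::nat)"
        by (metis dvd_times_left_cancel_iff mult.commute power_not_zero zero_neq_numeral)
      then show False by simp
    next
      case False
      have "theta m k > 0" using j by simp
      then have "k > 0" using False by (simp add: theta_def)
      moreover have "2 ^ q m dvd k" using d False by (metis dvd_mult_right theta_def)
      ultimately have "k \<in> S m" by (auto simp: S_def elim!: dvdE)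
      with False show False by simp
    qed
  qed
  then show ?thesis by (auto simp: theta_def[of n])
qed

text \<open>Combinatorial twin of the hypothesis on the given maps: \<open>g m\<close> copies only
  coordinates in the range of \<open>theta m\<close>, all outside \<open>S n\<close>, while
  \<open>g n\<close> alters \<alpha> only on \<open>S n\<close>, which contains its pivot
  \<open>2 ^ q n\<close>.\<close>

lemma g_absorb:
  assumes "m < n" shows "g m (g n \<alpha>) = g m \<alpha>"
proof
  fix k
  have "theta m k \<noteq> 2 ^ q n \<or> k = 2 ^ q m"
  proof (rule ccontr)
    assume "\<not> ?thesis"
    then have *: "theta m k = 2 ^ q n" by simp
    have "theta n (2 ^ q n) = 2 ^ q n * 3" by (auto simp: theta_def S_def)
    with theta_theta[OF assms, of k] * show False by simp
  qed
  then show "g m (g n \<alpha>) k = g m \<alpha> k"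
    by (auto simp: g_def theta_theta[OF assms])
qed

lemma agree_mono: "agree L \<alpha> \<beta> \<Longrightarrow> K \<le> L \<Longrightarrow> agree K \<alpha> \<beta>"
  by (simp add: agree_def)

lemma agree_dom_g:
  assumes "agree L \<alpha> \<beta>" "2 ^ q m < L"
  shows "\<alpha> \<in> dom_g m \<longleftrightarrow> \<beta> \<in> dom_g m"
  using assms by (auto simp: agree_def mem_dom_g mem_Nbhd_t)

lemma agree_dom_g_q:
  assumes "agree (q n) \<alpha> \<beta>" "m < n"
  shows "\<alpha> \<in> dom_g m \<longleftrightarrow> \<beta> \<in> dom_g m"
proof (rule agree_dom_g[OF assms(1)])
  have "(0::nat) < 2 ^ q m" by simp
  then show "2 ^ q m < q n" using pow_q_less_q[OF assms(2)] by linarith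
qed

section \<open>The forest of edges with the largest applicable index\<close>

definition active :: "nat \<Rightarrow> (nat \<Rightarrow> bool) \<Rightarrow> nat set" where
  "active n \<alpha> = {m. m < n \<and> \<alpha> \<in> dom_g m}"

definition step :: "nat \<Rightarrow> (nat \<Rightarrow> bool) \<Rightarrow> nat \<Rightarrow> bool" where
  "step n \<alpha> = (if active n \<alpha> = {} then \<alpha> else g (Max (active n \<alpha>)) \<alpha>)"

lemma finite_active [simp]: "finite (active n \<alpha>)"
  by (simp add: active_def)

lemma Max_active:
  assumes "active n \<alpha> \<noteq> {}"
  shows "Max (active n \<alpha>) < n" "\<alpha> \<in> dom_g (Max (active n \<alpha>))"
  using Max_in[OF finite_active assms] by (auto simp: active_def)

lemma agree_active: "agree (q n) \<alpha> \<beta> \<Longrightarrow> active n \<alpha> = active n \<beta>"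
  using agree_dom_g_q by (auto simp: active_def)

lemma step_Suc: "step (Suc n) \<alpha> = (if \<alpha> \<in> dom_g n then g n \<alpha> else step n \<alpha>)"
proof -
  have "active (Suc n) \<alpha> = (if \<alpha> \<in> dom_g n then insert n (active n \<alpha>) else active n \<alpha>)"
    by (auto simp: active_def less_Suc_eq)
  moreover have "Max (insert n (active n \<alpha>)) = n"
    by (rule Max_eqI) (auto simp: active_def)
  ultimately show ?thesis by (simp add: step_def)
qed

text \<open>Lexicographically beyond s. The maps g only move upwards in this order, so each of them is used at
  most once along an orbit of the forest.\<close>
definition passed :: "bool list \<Rightarrow> (nat \<Rightarrow> bool) \<Rightarrow> bool" where
  "passed s \<alpha> \<longleftrightarrow> (\<exists>k<length s. (\<forall>i<k. \<alpha> i = s ! i) \<and> \<alpha> k \<and> \<not> s ! k)"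

text \<open>Counts the indices that an orbit may still use. It drops at every proper step, which
  bounds orbits here and later provides the height function of the forest.\<close>

definition rank :: "nat \<Rightarrow> (nat \<Rightarrow> bool) \<Rightarrow> nat" where
  "rank n \<alpha> = card {m. m < n \<and> \<not> passed (t m @ [False]) \<alpha>}"

text \<open>Let \<open>k\<close> be the place where \<alpha> overtakes \<open>s\<close>. Below the
  pivot of \<open>g m\<close> nothing changes. If \<open>k\<close> lies above it, then \<alpha> and
  \<open>s\<close> are both 0 at the pivot, where \<open>g m\<close> writes 1, so the overtaking
  moves there.\<close>

lemma passed_g:
  assumes "passed s \<alpha>" "\<alpha> \<in> dom_g m" shows "passed s (g m \<alpha>)"
proof -
  obtain k where k: "k < length s" "\<forall>i<k. \<alpha> i = s ! i" "\<alpha> k" "\<not> s ! k"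
    using assms(1) by (auto simp: passed_def)
  have "\<not> \<alpha> (2 ^ q m)" using assms(2) by (simp add: mem_dom_g)
  then consider "k < 2 ^ q m" | "2 ^ q m < k" using k(3) by (metis linorder_neqE_nat)
  then show ?thesis
  proof cases
    case 1
    then have "(\<forall>i<k. g m \<alpha> i = s ! i) \<and> g m \<alpha> k" using k by (simp add: g_small)
    then show ?thesis using k by (auto simp: passed_def)
  next
    case 2
    then have "(\<forall>i<2 ^ q m. g m \<alpha> i = s ! i) \<and> \<not> s ! (2 ^ q m)"
      using k \<open>\<not> \<alpha> (2 ^ q m)\<close> by (auto simp: g_small)
    then show ?thesis using k(1) 2 g_pivot[of m \<alpha>] less_trans by (auto simp: passed_def)
  qed
qed

lemma passed_g_self:
  assumes "\<alpha> \<in> dom_g m" shows "passed (t m @ [False]) (g m \<alpha>)"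
  using assms g_pivot[of m \<alpha>]
  by (auto simp: passed_def mem_dom_g mem_Nbhd_t nth_append g_small intro!: exI[of _ "2 ^ q m"])

lemma not_passed_dom_g: "\<alpha> \<in> dom_g m \<Longrightarrow> \<not> passed (t m @ [False]) \<alpha>"
  by (auto simp: passed_def dom_g_def Nbhd_def)

lemma passed_step: "passed s \<alpha> \<Longrightarrow> passed s (step n \<alpha>)"
  using Max_active(2) passed_g by (auto simp: step_def)

lemma rank_step:
  assumes "active n \<alpha> \<noteq> {}" shows "rank n (step n \<alpha>) < rank n \<alpha>"
  unfolding rank_def
proof (rule psubset_card_mono)
  let ?M = "Max (active n \<alpha>)"
  have "?M \<in> {m. m < n \<and> \<not> passed (t m @ [False]) \<alpha>}"
    using Max_active[OF assms] not_passed_dom_g by simp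
  moreover have "?M \<notin> {m. m < n \<and> \<not> passed (t m @ [False]) (step n \<alpha>)}"
    using passed_g_self[OF Max_active(2)[OF assms]] assms by (simp add: step_def)
  ultimately show "{m. m < n \<and> \<not> passed (t m @ [False]) (step n \<alpha>)}
      \<subset> {m. m < n \<and> \<not> passed (t m @ [False]) \<alpha>}"
    using passed_step by blast
qed simp

lemma active_funpow_step: "active n ((step n ^^ n) \<alpha>) = {}"
proof (rule ccontr)
  assume *: "active n ((step n ^^ n) \<alpha>) \<noteq> {}"
  have fix1: "(step n ^^ j) \<beta> = \<beta>" if "active n \<beta> = {}" for \<beta> j
    using that by (induction j) (auto simp: step_def)
  \<comment> \<open>Each of the first \<open>j\<close> steps is proper and lowers the rank, which is
    at most \<open>n\<close> initially; a further proper step after \<open>n\<close> of them is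
    impossible.\<close>
  have "j \<le> n \<Longrightarrow> rank n ((step n ^^ j) \<alpha>) + j \<le> n" for j
  proof (induction j)
    case 0
    have "rank n \<alpha> \<le> card {..<n}" unfolding rank_def by (rule card_mono) auto
    then show ?case by simp
  next
    case (Suc j)
    have "active n ((step n ^^ j) \<alpha>) \<noteq> {}"
    proof
      assume a: "active n ((step n ^^ j) \<alpha>) = {}"
      have "(step n ^^ n) \<alpha> = (step n ^^ (n - j)) ((step n ^^ j) \<alpha>)"
        using Suc.prems by (metis Suc_leD funpow_add comp_apply le_add_diff_inverse2)
      with fix1[OF a] a * show False by simp
    qed
    from rank_step[OF this] Suc show ?case by simp
  qed
  from this[of n] rank_step[OF *] show False by simp
qed

section \<open>Finite quotients of the Cantor space\<close>

definition rel :: "nat \<Rightarrow> (nat \<Rightarrow> bool) \<Rightarrow> (nat \<Rightarrow> bool) \<Rightarrow> bool" where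
  "rel n \<alpha> \<beta> \<longleftrightarrow> (\<forall>j. agree (q n) ((step n ^^ j) \<alpha>) ((step n ^^ j) \<beta>))"

lemma rel_refl: "rel n \<alpha> \<alpha>" by (simp add: rel_def agree_def)
lemma rel_sym: "rel n \<alpha> \<beta> \<Longrightarrow> rel n \<beta> \<alpha>" by (simp add: rel_def agree_def)
lemma rel_trans: "rel n \<alpha> \<beta> \<Longrightarrow> rel n \<beta> \<gamma> \<Longrightarrow> rel n \<alpha> \<gamma>" by (simp add: rel_def agree_def)

lemma rel_agree: "rel n \<alpha> \<beta> \<Longrightarrow> agree (q n) \<alpha> \<beta>"
  unfolding rel_def by (metis funpow_0)

lemma rel_funpow: "rel n \<alpha> \<beta> \<Longrightarrow> rel n ((step n ^^ k) \<alpha>) ((step n ^^ k) \<beta>)"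
  unfolding rel_def by (metis comp_apply funpow_add)

lemma rel_step: "rel n \<alpha> \<beta> \<Longrightarrow> rel n (step n \<alpha>) (step n \<beta>)"
  using rel_funpow[of n \<alpha> \<beta> 1] by simp

text \<open>The first \<open>q n\<close> digits contain every position at which
  \<open>t m @ [False]\<close> is inspected, so the height descends to classes.\<close>

lemma rel_rank:
  assumes "rel n \<alpha> \<beta>" shows "rank n \<alpha> = rank n \<beta>"
proof -
  have "passed (t m @ [False]) \<alpha> \<longleftrightarrow> passed (t m @ [False]) \<beta>" if "m < n" for m
  proof -
    have "2 ^ q m < q n" using pow_q_less_q[OF that] zero_less_power[of "2::nat" "q m"] by linarith
    then have "\<forall>i<Suc (2 ^ q m). \<alpha> i = \<beta> i"
      using rel_agree[OF assms] by (auto simp: agree_def)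
    then show ?thesis unfolding passed_def
      by (intro ex_cong conj_cong refl all_cong) auto
  qed
  then show ?thesis unfolding rank_def by (intro arg_cong[where f=card]) auto
qed

text \<open>Digit \<open>k\<close> of the image is the pivot or a digit of the argument at a place
  at most \<open>2 * k + c\<close>. Measuring lengths as \<open>X - c\<close> turns this loss into
  an exact halving of \<open>X\<close>.\<close>

lemma agree_step:
  assumes n: "n = Suc p" and c: "c = 2 ^ q p" and ag: "agree (2 * X - c) \<alpha> \<beta>" and X: "4 * c \<le> X"
  shows "agree (X - c) (step n \<alpha>) (step n \<beta>)"
proof -
  have qn: "q n = 3 * c" using n c by simp
  have "agree (q n) \<alpha> \<beta>" by (rule agree_mono[OF ag]) (use qn X in linarith)
  from agree_active[OF this] have act: "active n \<alpha> = active n \<beta>" .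
  show ?thesis
  proof (cases "active n \<beta> = {}")
    case True
    then have "step n \<alpha> = \<alpha>" "step n \<beta> = \<beta>" using act by (simp_all add: step_def)
    then show ?thesis using agree_mono[OF ag, of "X - c"] by simp
  next
    case False
    define M where "M = Max (active n \<beta>)"
    have "M < n" using Max_active(1)[OF False] by (simp add: M_def)
    then have "2 ^ q M \<le> c"
      using n c strict_mono_less_eq[OF q_strict_mono] by (auto intro!: power_increasing)
    then have "theta M k < 2 * X - c" if "k < X - c" for k
      using theta_le[of M k] that by linarith
    then show ?thesis using ag False act
      by (auto simp: step_def agree_def g_def M_def[symmetric])
  qed
qed

text \<open>At most \<open>n\<close> steps move the point, and each roughly halves the number of
  known digits. From \<open>2 ^ q n\<close> digits at least \<open>3 * c\<close>, which is
  \<open>q n\<close>, survive; this uses the fast growth of \<open>q\<close>.\<close>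

lemma agree_imp_rel:
  assumes "agree (2 ^ q n) \<alpha> \<beta>" shows "rel n \<alpha> \<beta>"
proof (cases n)
  case 0
  then show ?thesis by (simp add: rel_def agree_def)
next
  case (Suc p)
  define c :: nat where "c = 2 ^ q p"
  have qn: "q n = 3 * c" by (simp add: Suc c_def)
  have *: "agree (2 ^ (n - j) * (4 * c) - c) ((step n ^^ j) \<alpha>) ((step n ^^ j) \<beta>)" if "j \<le> n" for j
    using that
  proof (induction j)
    case 0
    have "q p + 1 \<le> c" using less_exp[of "q p"] unfolding c_def by linarith
    then have "n + 2 + q p \<le> q n" using le_q[of p] Suc qn by linarith
    then have "(2::nat) ^ (n + 2 + q p) \<le> 2 ^ q n" by (rule power_increasing) simp
    moreover have "(2::nat) ^ (n + 2 + q p) = 2 ^ n * (4 * c)"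
      by (simp add: power_add c_def)
    ultimately show ?case using agree_mono[OF assms] by simp
  next
    case (Suc j)
    define X where "X = 2 ^ (n - Suc j) * (4 * c)"
    have "2 ^ (n - j) * (4 * c) = 2 * X"
      using Suc.prems by (simp add: X_def Suc_diff_Suc flip: power_Suc)
    then have "agree (2 * X - c) ((step n ^^ j) \<alpha>) ((step n ^^ j) \<beta>)"
      using Suc.IH Suc.prems by (metis Suc_leD)
    then show ?case
      using agree_step[OF \<open>n = Suc p\<close> c_def, of X] by (simp add: X_def)
  qed
  have le: "q n \<le> 2 ^ (n - j) * (4 * c) - c" for j
  proof -
    have "4 * c \<le> 2 ^ (n - j) * (4 * c)" by simp
    then show ?thesis using qn by linarith
  qed
  have "agree (q n) ((step n ^^ j) \<alpha>) ((step n ^^ j) \<beta>)" for j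
  proof (cases "j \<le> n")
    case True
    then show ?thesis using agree_mono[OF * le] by blast
  next
    case False
    \<comment> \<open>After \<open>n\<close> steps the orbit rests at a root, so the bound for
      \<open>j = n\<close> covers all later iterates.\<close>
    have "(step n ^^ k) ((step n ^^ n) \<gamma>) = (step n ^^ n) \<gamma>" for k \<gamma>
      using active_funpow_step[of n \<gamma>] by (induction k) (auto simp: step_def)
    then have "(step n ^^ j) \<gamma> = (step n ^^ n) \<gamma>" for \<gamma>
      using False by (metis comp_apply funpow_add le_add_diff_inverse2 nat_le_linear)
    then show ?thesis using agree_mono[OF *[of n] le] by simp
  qed
  then show ?thesis by (simp add: rel_def)
qed

text \<open>Both ends of every edge of \<open>g n\<close> thus lie in one class of stage
  \<open>n\<close>, so adding these edges means joining two nearby copies of one vertex.\<close>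

lemma rel_Nbhd_t: "\<alpha> \<in> Nbhd (t n) \<Longrightarrow> \<beta> \<in> Nbhd (t n) \<Longrightarrow> rel n \<alpha> \<beta>"
  by (rule agree_imp_rel) (simp add: agree_def mem_Nbhd_t)

lemma rel_dom_g:
  assumes "rel n \<alpha> \<beta>" "m < n" shows "\<alpha> \<in> dom_g m \<longleftrightarrow> \<beta> \<in> dom_g m"
  using agree_dom_g_q[OF rel_agree[OF assms(1)] assms(2)] .

text \<open>Follow the finer orbits until they meet \<open>dom_g n\<close>. Before that both forests
  take the same steps; on arrival both points extend \<open>t n\<close>, and
  \<open>rel_Nbhd_t\<close> settles the rest.\<close>

lemma rel_Suc:
  assumes "rel (Suc n) \<alpha> \<beta>" shows "rel n \<alpha> \<beta>"
proof -
  have "rel (Suc n) \<alpha> \<beta> \<Longrightarrow> agree (q n) ((step n ^^ j) \<alpha>) ((step n ^^ j) \<beta>)" for j \<alpha> \<beta>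
  proof (induction j arbitrary: \<alpha> \<beta>)
    case 0
    show ?case using agree_mono[OF rel_agree[OF 0]] q_mono_Suc[of n] by simp
  next
    case (Suc j)
    show ?case
    proof (cases "\<alpha> \<in> dom_g n")
      case True
      moreover have "\<beta> \<in> dom_g n" using True rel_dom_g[OF Suc.prems] by simp
      ultimately have "rel n \<alpha> \<beta>" by (simp add: rel_Nbhd_t mem_dom_g)
      then show ?thesis by (simp add: rel_def del: funpow.simps)
    next
      case False
      moreover have "\<beta> \<notin> dom_g n" using False rel_dom_g[OF Suc.prems] by simp
      ultimately have "rel (Suc n) (step n \<alpha>) (step n \<beta>)"
        using rel_step[OF Suc.prems] by (simp add: step_Suc)
      from Suc.IH[OF this] show ?thesis by (simp add: funpow_swap1)
    qed
  qed
  then show ?thesis using assms by (simp add: rel_def)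
qed

definition rep :: "nat \<Rightarrow> (nat \<Rightarrow> bool) \<Rightarrow> nat \<Rightarrow> bool" where
  "rep n \<alpha> = (SOME \<beta>. rel n \<alpha> \<beta>)"

lemma rel_rep: "rel n \<alpha> (rep n \<alpha>)"
  unfolding rep_def by (rule someI[of _ \<alpha>]) (rule rel_refl)

lemma rep_eq_iff: "rep n \<alpha> = rep n \<beta> \<longleftrightarrow> rel n \<alpha> \<beta>"
proof
  assume "rel n \<alpha> \<beta>"
  then have "rel n \<alpha> = rel n \<beta>" using rel_sym rel_trans by blast
  then show "rep n \<alpha> = rep n \<beta>" by (simp add: rep_def)
next
  assume "rep n \<alpha> = rep n \<beta>"
  then show "rel n \<alpha> \<beta>" using rel_rep rel_sym rel_trans by metis
qed

lemma finite_range_rep: "finite (range (rep n))"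
proof -
  let ?T = "(\<lambda>A k. k \<in> A) ` Pow {..<(2::nat) ^ q n} :: (nat \<Rightarrow> bool) set"
  have "rep n \<alpha> \<in> rep n ` ?T" for \<alpha>
  proof (rule image_eqI)
    \<comment> \<open>Clearing all digits from \<open>2 ^ q n\<close> on does not leave the class,
      so finitely many candidates suffice.\<close>
    show "rep n \<alpha> = rep n (\<lambda>k. k \<in> {k. k < 2 ^ q n \<and> \<alpha> k})"
      unfolding rep_eq_iff by (rule agree_imp_rel) (simp add: agree_def)
    show "(\<lambda>k. k \<in> {k. k < 2 ^ q n \<and> \<alpha> k}) \<in> ?T" by (rule imageI) auto
  qed
  then have "range (rep n) \<subseteq> rep n ` ?T" by blast
  moreover have "finite ?T" by simp
  ultimately show ?thesis using finite_surj by blast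
qed

text \<open>Decides which of two copies a point follows at the next stage. It is constant along
  forest edges of index below \<open>n\<close> and switches from true to false along edges of
  \<open>g n\<close>.\<close>

definition hits :: "nat \<Rightarrow> (nat \<Rightarrow> bool) \<Rightarrow> bool" where
  "hits n \<alpha> \<longleftrightarrow> (\<exists>j. (step (Suc n) ^^ j) \<alpha> \<in> dom_g n)"

lemma hits_rel: "rel (Suc n) \<alpha> \<beta> \<Longrightarrow> hits n \<alpha> \<longleftrightarrow> hits n \<beta>"
  using rel_dom_g[OF rel_funpow] unfolding hits_def by blast

lemma hits_dom_g: "\<alpha> \<in> dom_g n \<Longrightarrow> hits n \<alpha>"
  unfolding hits_def by (rule exI[of _ 0]) simp

text \<open>The edge carries the point beyond \<open>t n @ [False]\<close>, and no later step brings
  it back.\<close>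

lemma not_hits_g:
  assumes "\<alpha> \<in> dom_g n" shows "\<not> hits n (g n \<alpha>)"
proof -
  have "passed (t n @ [False]) ((step (Suc n) ^^ j) (g n \<alpha>))" for j
    by (induction j) (use passed_g_self[OF assms] passed_step in auto)
  then show ?thesis using not_passed_dom_g unfolding hits_def by blast
qed

lemma hits_step:
  assumes "\<alpha> \<notin> dom_g n" shows "hits n (step n \<alpha>) \<longleftrightarrow> hits n \<alpha>"
proof -
  have "step n \<alpha> = step (Suc n) \<alpha>" using assms by (simp add: step_Suc)
  then have "hits n (step n \<alpha>) \<longleftrightarrow> (\<exists>j. (step (Suc n) ^^ Suc j) \<alpha> \<in> dom_g n)"
    by (simp add: hits_def funpow_swap1)
  also have "\<dots> \<longleftrightarrow> hits n \<alpha>"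
    unfolding hits_def using assms by (metis funpow_0 old.nat.exhaust)
  finally show ?thesis .
qed

subsection \<open>Families of points indexed by a finite forest\<close>

locale absorbing_situation =
  fixes D :: "nat \<Rightarrow> 'a::polish_space set" and f :: "nat \<Rightarrow> 'a \<Rightarrow> 'a"
  assumes situation: "complex_situation D f"
    and absorb: "\<And>m n x. m < n \<Longrightarrow> x \<in> D n \<Longrightarrow> f n x \<in> D m \<Longrightarrow> x \<in> D m
           \<Longrightarrow> f m (f n x) = f m x"
begin

section \<open>Recurrence near the diagonal and multiplicity of preimages\<close>

lemma open_D: "open (D n)"
  using situation by (simp add: complex_situation_def)

lemma open_image: "open U \<Longrightarrow> open (f n ` (U \<inter> D n))"
  using situation by (simp add: complex_situation_def open_Int)

lemma open_preimage: "open U \<Longrightarrow> open (D n \<inter> f n -` U)"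
  using situation by (auto simp: complex_situation_def intro: continuous_open_preimage)

lemma f_neq: "x \<in> D n \<Longrightarrow> f n x \<noteq> x"
proof
  assume "x \<in> D n" "f n x = x"
  then have "(x, x) \<in> Af D f" by (force simp: Af_def graph_of_def)
  then show False using situation by (auto simp: complex_situation_def)
qed

lemma recurrence:
  assumes "open U" "U \<noteq> {}"
  obtains n y where "y \<in> D n" "y \<in> U" "f n y \<in> U"
proof -
  obtain x where "x \<in> U" using assms by blast
  moreover have "(x, x) \<in> closure (Af D f)"
    using situation by (auto simp: complex_situation_def)
  ultimately have "(U \<times> U) \<inter> closure (Af D f) \<noteq> {}" by blast
  then have "(U \<times> U) \<inter> Af D f \<noteq> {}"
    using open_Int_closure_eq_empty[OF open_Times[OF assms(1) assms(1)]] by blast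
  then show thesis using that by (auto simp: Af_def graph_of_def)
qed

text \<open>No map fixes a point, so around a point of its domain there is an open set that the map
  sends off itself. Shrinking once for each index below \<open>N\<close> leaves only indices at
  least \<open>N\<close> for recurrence.\<close>

lemma recurrence_ge:
  assumes "open U" "U \<noteq> {}"
  obtains n y where "N \<le> n" "y \<in> D n" "y \<in> U" "f n y \<in> U"
proof -
  have "\<exists>V\<subseteq>U. open V \<and> V \<noteq> {} \<and> (\<forall>n<N. \<forall>y\<in>D n \<inter> V. f n y \<notin> V)"
  proof (induction N)
    case 0
    then show ?case using assms by blast
  next
    case (Suc N)
    then obtain V where V: "V \<subseteq> U" "open V" "V \<noteq> {}" "\<forall>n<N. \<forall>y\<in>D n \<inter> V. f n y \<notin> V"
      by blast
    show ?case
    proof (cases "D N \<inter> V = {}")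
      case True
      then show ?thesis using V by (intro exI[of _ V]) (auto simp: less_Suc_eq)
    next
      case False
      then obtain x where x: "x \<in> D N" "x \<in> V" by blast
      obtain P Q where PQ: "open P" "open Q" "x \<in> P" "f N x \<in> Q" "P \<inter> Q = {}"
        using hausdorff[of x "f N x"] f_neq[OF x(1)] by metis
      define V' where "V' = V \<inter> P \<inter> (D N \<inter> f N -` Q)"
      have "open V'" unfolding V'_def by (intro open_Int V PQ open_preimage)
      moreover have "x \<in> V'" using x PQ by (simp add: V'_def)
      moreover have "\<forall>n<Suc N. \<forall>y\<in>D n \<inter> V'. f n y \<notin> V'"
        using V(4) PQ(5) by (auto simp: V'_def less_Suc_eq)
      ultimately show ?thesis using V(1) by (intro exI[of _ V']) (auto simp: V'_def)
    qed
  qed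
  then obtain V where V: "V \<subseteq> U" "open V" "V \<noteq> {}" "\<forall>n<N. \<forall>y\<in>D n \<inter> V. f n y \<notin> V"
    by blast
  obtain n y where "y \<in> D n" "y \<in> V" "f n y \<in> V" using recurrence[OF V(2,3)] .
  then show thesis using that V by (metis IntI linorder_not_less subsetD)
qed

text \<open>A finite one would contain an open singleton, where recurrence would yield a fixed
  point.\<close>

lemma infinite_open:
  fixes U :: "'a set"
  assumes "open U" "U \<noteq> {}" shows "infinite U"
proof
  assume fin: "finite U"
  obtain x where x: "x \<in> U" using assms by blast
  have "closed (U - {x})" by (rule finite_imp_closed) (simp add: fin)
  then have "open (U - (U - {x}))" by (rule open_Diff[OF assms(1)])
  moreover have "U - (U - {x}) = {x}" using x by blast
  ultimately have "open {x}" by simp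
  then obtain n y where "y \<in> D n" "y \<in> {x}" "f n y \<in> {x}" by (rule recurrence) simp
  then show False using f_neq by auto
qed

text \<open>Let \<open>f n\<close> with \<open>n > m\<close> move \<open>y\<close> within
  \<open>H\<close>. By absorption \<open>u\<close> and \<open>f n u\<close> have the same image
  under \<open>f m\<close>, so the sets found inductively near \<open>y\<close> share an image point
  with a disjoint neighbourhood of \<open>f n y\<close>.\<close>

lemma disjoint_same_image:
  assumes "open H" "H \<noteq> {}" "H \<subseteq> D m"
  shows "\<exists>C z. finite C \<and> card C = Suc K \<and> disjoint C \<and> (\<forall>V\<in>C. open V \<and> V \<subseteq> H \<and> z \<in> f m ` V)"
  using assms
proof (induction K arbitrary: H)
  case 0
  then obtain x where "x \<in> H" by blast
  then show ?case using 0 by (intro exI[of _ "{H}"] exI[of _ "f m x"]) auto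
next
  case (Suc K)
  obtain n y where n: "Suc m \<le> n" "y \<in> D n" "y \<in> H" "f n y \<in> H"
    using recurrence_ge[OF Suc.prems(1,2)] .
  obtain P Q where PQ: "open P" "open Q" "y \<in> P" "f n y \<in> Q" "P \<inter> Q = {}"
    using hausdorff[of y "f n y"] f_neq[OF n(2)] by metis
  define V where "V = H \<inter> P \<inter> (D n \<inter> f n -` (Q \<inter> H))"
  have "open V" unfolding V_def by (intro open_Int Suc.prems PQ open_preimage)
  moreover have "V \<noteq> {}" using n PQ by (auto simp: V_def)
  moreover have "V \<subseteq> D m" using Suc.prems by (auto simp: V_def)
  ultimately obtain C z where C: "finite C" "card C = Suc K" "disjoint C"
      "\<forall>W\<in>C. open W \<and> W \<subseteq> V \<and> z \<in> f m ` W"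
    using Suc.IH by blast
  obtain W where "W \<in> C" using C(2) by fastforce
  then obtain u where u: "u \<in> V" "z = f m u" using C(4) by blast
  have "f m (f n u) = z"
    using u Suc.prems n(1) by (subst absorb) (auto simp: V_def)
  then have z: "z \<in> f m ` (Q \<inter> H)" using u(1) by (auto simp: V_def intro!: image_eqI[of z "f m" "f n u"])
  have dj: "W \<inter> (Q \<inter> H) = {}" if "W \<in> C" for W
  proof -
    have "W \<subseteq> P" using C(4) that by (auto simp: V_def)
    then show ?thesis using PQ(5) by blast
  qed
  have "Q \<inter> H \<notin> C" using dj[of "Q \<inter> H"] z by auto
  then have "card (insert (Q \<inter> H) C) = Suc (Suc K)" using C by simp
  moreover have "disjoint (insert (Q \<inter> H) C)"
    using C(3) dj by (auto simp: disjoint_def)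
  moreover have "\<forall>W\<in>insert (Q \<inter> H) C. open W \<and> W \<subseteq> H \<and> z \<in> f m ` W"
    using C(4) z Suc.prems(1) PQ(2) by (auto simp: V_def)
  ultimately show ?case using C(1)
    by (intro exI[of _ "insert (Q \<inter> H) C"] exI[of _ z]) auto
qed

text \<open>An open form of having more than \<open>K\<close> preimages in \<open>U\<close>:
  disjoint open sets around the preimages make the condition stable, because images of open sets are
  open.\<close>

definition many :: "nat \<Rightarrow> nat \<Rightarrow> 'a set \<Rightarrow> 'a set" where
  "many m K U = \<Union> {\<Inter>V\<in>C. f m ` V | C. finite C \<and> card C = Suc K \<and> disjoint C
     \<and> (\<forall>V\<in>C. open V \<and> V \<subseteq> U \<inter> D m)}"

lemma open_many: "open (many m K U)"
  unfolding many_def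
proof (rule open_Union, safe)
  fix C assume C: "finite C" "\<forall>V\<in>C. open V \<and> V \<subseteq> U \<inter> D m"
  have "open (f m ` V)" if "V \<in> C" for V
    using open_image[of V m] C(2) that by (simp add: Int_absorb2)
  then show "open (\<Inter>V\<in>C. f m ` V)" using C(1) by (intro open_INT) auto
qed

lemma many_avoid:
  assumes "z \<in> many m K U" "finite F" "card F \<le> K"
  obtains y where "y \<in> U" "y \<in> D m" "f m y = z" "y \<notin> F"
proof -
  obtain C where C: "finite C" "card C = Suc K" "disjoint C"
      "\<forall>V\<in>C. open V \<and> V \<subseteq> U \<inter> D m" "\<forall>V\<in>C. z \<in> f m ` V"
    using assms(1) by (auto simp: many_def)
  then have "\<forall>V\<in>C. \<exists>y. y \<in> V \<and> f m y = z" by force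
  then obtain c where c: "\<forall>V\<in>C. c V \<in> V \<and> f m (c V) = z" by metis
  have "inj_on c C"
    using c C(3) by (intro inj_onI) (metis IntI disjointD empty_iff)
  then have "card (c ` C) = Suc K" using C(2) by (simp add: card_image)
  then have "\<not> c ` C \<subseteq> F" using card_mono[OF assms(2), of "c ` C"] assms(3) by auto
  then obtain V where "V \<in> C" "c V \<notin> F" by blast
  then show thesis using that[of "c V"] c C(4) by blast
qed

text \<open>A vertex w with label Some n is joined to its parent by the map f n; roots are labelled
  None.\<close>
definition forest :: "'w set \<Rightarrow> ('w \<Rightarrow> 'w) \<Rightarrow> ('w \<Rightarrow> nat option) \<Rightarrow> ('w \<Rightarrow> nat) \<Rightarrow> bool" where
  "forest W p lab rk \<longleftrightarrow> finite W \<and> (\<forall>w\<in>W. lab w \<noteq> None \<longrightarrow> p w \<in> W \<and> rk (p w) < rk w)"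

definition valid :: "'w set \<Rightarrow> ('w \<Rightarrow> 'w) \<Rightarrow> ('w \<Rightarrow> nat option) \<Rightarrow> ('w \<Rightarrow> 'a) \<Rightarrow> bool" where
  "valid W p lab x \<longleftrightarrow> (\<forall>w\<in>W. \<forall>n. lab w = Some n \<longrightarrow> x w \<in> D n \<and> f n (x w) = x (p w))"

section \<open>Small perturbations of realised forests\<close>

lemma forest_leaf:
  assumes "forest W p lab rk" "W \<noteq> {}"
  obtains l where "l \<in> W" "forest (W - {l}) p lab rk" "\<And>w. w \<in> W \<Longrightarrow> lab w \<noteq> None \<Longrightarrow> p w \<noteq> l"
proof -
  have fin: "finite W" using assms by (simp add: forest_def)
  \<comment> \<open>A vertex of maximal height is nobody's parent.\<close>
  then have "Max (rk ` W) \<in> rk ` W" using assms(2) by (intro Max_in) auto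
  then obtain l where l: "l \<in> W" "rk l = Max (rk ` W)" by auto
  then have max: "rk w \<le> rk l" if "w \<in> W" for w using fin that by simp
  have nl: "p w \<noteq> l" if "w \<in> W" "lab w \<noteq> None" for w
    using assms(1) that max[OF that(1)] by (auto simp: forest_def)
  then have "forest (W - {l}) p lab rk" using assms(1) by (auto simp: forest_def)
  then show thesis using that l(1) nl by blast
qed

lemma valid_extend:
  assumes "valid (W - {l}) p lab x" "\<And>w. w \<in> W \<Longrightarrow> lab w \<noteq> None \<Longrightarrow> p w \<noteq> l"
    and "l \<in> W" "\<And>n. lab l = Some n \<Longrightarrow> y \<in> D n \<and> f n y = x (p l)"
  shows "valid W p lab (x(l := y))"
  using assms by (auto simp: valid_def)

lemma valid_mono: "valid W p lab x \<Longrightarrow> V \<subseteq> W \<Longrightarrow> valid V p lab x"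
  by (auto simp: valid_def)

text \<open>Leaves are stripped by induction. A leaf other than \<open>v\<close> is restored through
  openness. If the leaf is \<open>v\<close>, its value is pushed to the parent by continuity, and
  the parent becomes the prescribed vertex.\<close>

lemma perturb_prescribed:
  assumes "forest W p lab rk" "valid W p lab x" "v \<in> W" "\<And>w. w \<in> W \<Longrightarrow> open (U w) \<and> x w \<in> U w"
  shows "\<exists>B. open B \<and> x v \<in> B \<and>
    (\<forall>y\<in>B. \<exists>x'. valid W p lab x' \<and> x' v = y \<and> (\<forall>w\<in>W. x' w \<in> U w))"
  using assms
proof (induction "card W" arbitrary: W U v)
  case 0
  then show ?case by (auto simp: forest_def)
next
  case (Suc k)
  obtain l where l: "l \<in> W" "forest (W - {l}) p lab rk"
      and nl: "\<And>w. w \<in> W \<Longrightarrow> lab w \<noteq> None \<Longrightarrow> p w \<noteq> l"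
    using forest_leaf[OF Suc.prems(1)] Suc.prems(3) by blast
  have k: "k = card (W - {l})" using Suc.hyps(2) l(1) by simp
  have val: "valid (W - {l}) p lab x" using Suc.prems(2) by (rule valid_mono) auto
  note IH = Suc.hyps(1)[OF k l(2) val]
  show ?case
  proof (cases "v = l")
    case False
    \<comment> \<open>Confining the parent to the image of \<open>U l\<close> ensures that the leaf
      can be lifted afterwards.\<close>
    define U' where "U' = (case lab l of None \<Rightarrow> U
      | Some n \<Rightarrow> U(p l := U (p l) \<inter> f n ` (U l \<inter> D n)))"
    have U': "open (U' w) \<and> x w \<in> U' w" if "w \<in> W - {l}" for w
    proof (cases "lab l")
      case None
      then show ?thesis using Suc.prems(4) that by (simp add: U'_def)
    next
      case (Some n)
      have "x (p l) = f n (x l)" "x l \<in> D n" using Suc.prems(2) l(1) Some by (auto simp: valid_def)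
      then have "x (p l) \<in> f n ` (U l \<inter> D n)" using Suc.prems(4)[OF l(1)] by auto
      then show ?thesis using Suc.prems(4) that l(1) by (auto simp: U'_def Some intro: open_image)
    qed
    have "v \<in> W - {l}" using False Suc.prems(3) by simp
    from IH[OF this U'] obtain B where B: "open B" "x v \<in> B"
      "\<forall>y\<in>B. \<exists>x'. valid (W - {l}) p lab x' \<and> x' v = y \<and> (\<forall>w\<in>W - {l}. x' w \<in> U' w)" by blast
    have "\<exists>x'. valid W p lab x' \<and> x' v = y \<and> (\<forall>w\<in>W. x' w \<in> U w)" if y: "y \<in> B" for y
    proof -
      obtain x' where x': "valid (W - {l}) p lab x'" "x' v = y" "\<forall>w\<in>W - {l}. x' w \<in> U' w"
        using B(3) y by blast
      have sub: "x' w \<in> U w" if "w \<in> W - {l}" for w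
        using x'(3) that by (auto simp: U'_def split: option.splits if_splits)
      have "\<exists>z\<in>U l. \<forall>n. lab l = Some n \<longrightarrow> z \<in> D n \<and> f n z = x' (p l)"
      proof (cases "lab l")
        case None
        then show ?thesis using Suc.prems(4)[OF l(1)] by auto
      next
        case (Some n)
        have "p l \<in> W - {l}" using nl[OF l(1)] Some Suc.prems(1) l(1) by (auto simp: forest_def)
        then have "x' (p l) \<in> f n ` (U l \<inter> D n)" using bspec[OF x'(3), of "p l"] Some by (simp add: U'_def)
        then show ?thesis using Some by auto
      qed
      then obtain z where z: "z \<in> U l" "\<And>n. lab l = Some n \<Longrightarrow> z \<in> D n \<and> f n z = x' (p l)"
        by blast
      have "valid W p lab (x'(l := z))" by (rule valid_extend[OF x'(1) nl l(1) z(2)])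
      moreover have "(x'(l := z)) v = y" using False x'(2) by simp
      moreover have "\<forall>w\<in>W. (x'(l := z)) w \<in> U w" using sub z(1) by auto
      ultimately show ?thesis by blast
    qed
    then show ?thesis using B by blast
  next
    case True
    show ?thesis
    proof (cases "lab l")
      case None
      have "valid W p lab (x(l := y))" for y
        by (rule valid_extend[OF val nl l(1)]) (use None in auto)
      then have "\<exists>x'. valid W p lab x' \<and> x' v = y \<and> (\<forall>w\<in>W. x' w \<in> U w)" if "y \<in> U l" for y
        using that True Suc.prems(4) by (intro exI[of _ "x(l := y)"]) auto
      then show ?thesis using Suc.prems(4)[OF l(1)] True by blast
    next
      case (Some n)
      have "p l \<in> W - {l}" using nl[OF l(1)] Some Suc.prems(1) l(1) by (auto simp: forest_def)
      from IH[OF this, of U] obtain B where B: "open B" "x (p l) \<in> B"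
        "\<forall>y\<in>B. \<exists>x'. valid (W - {l}) p lab x' \<and> x' (p l) = y \<and> (\<forall>w\<in>W - {l}. x' w \<in> U w)"
        using Suc.prems(4) by blast
      have x: "x l \<in> D n" "f n (x l) = x (p l)"
        using Suc.prems(2) l(1) Some by (auto simp: valid_def)
      have "\<exists>x'. valid W p lab x' \<and> x' v = y \<and> (\<forall>w\<in>W. x' w \<in> U w)"
        if y: "y \<in> U l \<inter> (D n \<inter> f n -` B)" for y
      proof -
        obtain x' where x': "valid (W - {l}) p lab x'" "x' (p l) = f n y" "\<forall>w\<in>W - {l}. x' w \<in> U w"
          using B(3) y by blast
        have "valid W p lab (x'(l := y))"
          by (rule valid_extend[OF x'(1) nl l(1)]) (use y x'(2) Some in auto)
        then show ?thesis using True x'(3) y by (intro exI[of _ "x'(l := y)"]) auto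
      qed
      moreover have "open (U l \<inter> (D n \<inter> f n -` B))"
        using Suc.prems(4)[OF l(1)] B(1) by (intro open_Int open_preimage) auto
      moreover have "x v \<in> U l \<inter> (D n \<inter> f n -` B)"
        using True Suc.prems(4)[OF l(1)] x B(2) by simp
      ultimately show ?thesis by blast
    qed
  qed
qed

text \<open>Equivalently, \<open>x\<close> lies in the interior of the closure of the open set
  \<open>U\<close>; it may lie outside \<open>U\<close> itself.\<close>

definition loc_dense :: "'a set \<Rightarrow> 'a \<Rightarrow> bool" where
  "loc_dense U x \<longleftrightarrow> open U \<and> (\<exists>G. open G \<and> x \<in> G \<and> (\<forall>B. open B \<and> B \<noteq> {} \<and> B \<subseteq> G \<longrightarrow> B \<inter> U \<noteq> {}))"

lemma loc_dense_open: "open U \<Longrightarrow> x \<in> U \<Longrightarrow> loc_dense U x"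
  unfolding loc_dense_def by blast

lemma loc_dense_nonempty: "loc_dense U x \<Longrightarrow> open U \<and> U \<noteq> {}"
  unfolding loc_dense_def by blast

text \<open>Lets several leaves impose conditions on one parent. As \<open>U\<close> is open, the
  density of \<open>V\<close> applies inside \<open>B \<inter> U\<close>.\<close>

lemma loc_dense_Int:
  assumes "loc_dense U x" "loc_dense V x" shows "loc_dense (U \<inter> V) x"
proof -
  obtain G H where *: "open U" "open V" "open G" "x \<in> G" "open H" "x \<in> H"
    "\<forall>B. open B \<and> B \<noteq> {} \<and> B \<subseteq> G \<longrightarrow> B \<inter> U \<noteq> {}"
    "\<forall>B. open B \<and> B \<noteq> {} \<and> B \<subseteq> H \<longrightarrow> B \<inter> V \<noteq> {}"
    using assms unfolding loc_dense_def by blast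
  have "B \<inter> (U \<inter> V) \<noteq> {}" if "open B" "B \<noteq> {}" "B \<subseteq> G \<inter> H" for B
  proof -
    have "open (B \<inter> U)" "B \<inter> U \<noteq> {}" "B \<inter> U \<subseteq> H" using * that by (auto intro: open_Int)
    then show ?thesis using *(8) by blast
  qed
  then show ?thesis unfolding loc_dense_def using *
    by (intro conjI open_Int exI[of _ "G \<inter> H"]) auto
qed

text \<open>An open piece \<open>B\<close> of the image is pulled back near \<open>x\<close> and
  meets \<open>U\<close> there; inside this open intersection \<open>disjoint_same_image\<close>
  finds a point of \<open>B\<close> with enough preimages.\<close>

lemma loc_dense_many:
  assumes "loc_dense U x" "x \<in> D m" shows "loc_dense (many m K U) (f m x)"
proof -
  obtain G where G: "open U" "open G" "x \<in> G"
    "\<forall>B. open B \<and> B \<noteq> {} \<and> B \<subseteq> G \<longrightarrow> B \<inter> U \<noteq> {}"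
    using assms(1) unfolding loc_dense_def by blast
  have "B \<inter> many m K U \<noteq> {}" if B: "open B" "B \<noteq> {}" "B \<subseteq> f m ` (G \<inter> D m)" for B
  proof -
    define H where "H = G \<inter> (D m \<inter> f m -` B)"
    have "open H" unfolding H_def by (intro open_Int G open_preimage B)
    moreover have "H \<noteq> {}" using B by (auto simp: H_def)
    ultimately have "H \<inter> U \<noteq> {}" "open (H \<inter> U)" using G by (auto simp: H_def)
    then obtain C z where C: "finite C" "card C = Suc K" "disjoint C"
        "\<forall>V\<in>C. open V \<and> V \<subseteq> H \<inter> U \<and> z \<in> f m ` V"
      using disjoint_same_image[of "H \<inter> U" m K] by (auto simp: H_def)
    then have "z \<in> (\<Inter>V\<in>C. f m ` V)" "\<forall>V\<in>C. open V \<and> V \<subseteq> U \<inter> D m"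
      by (auto simp: H_def)
    then have "z \<in> many m K U" unfolding many_def using C by blast
    moreover have "z \<in> B"
    proof -
      obtain V where "V \<in> C" using C(2) by fastforce
      then show ?thesis using C(4) by (fastforce simp: H_def)
    qed
    ultimately show ?thesis by blast
  qed
  moreover have "f m x \<in> f m ` (G \<inter> D m)" using G(3) assms(2) by simp
  ultimately show ?thesis unfolding loc_dense_def
    by (intro conjI open_many exI[of _ "f m ` (G \<inter> D m)"] open_image[OF G(2)]) auto
qed

text \<open>Leaves are removed one at a time. A removed leaf restricts its parent to the values that have
  enough preimages near the leaf; this is a dense open condition near the old value, whence
  \<^const>\<open>loc_dense\<close> instead of neighbourhoods.\<close>
lemma perturb_injective:
  assumes "forest W p lab rk" "valid W p lab x" "\<And>w. w \<in> W \<Longrightarrow> loc_dense (U w) (x w)"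
  shows "\<exists>x'. valid W p lab x' \<and> inj_on x' W \<and> (\<forall>w\<in>W. x' w \<in> U w)"
  using assms
proof (induction "card W" arbitrary: W U)
  case 0
  then show ?case by (auto simp: forest_def valid_def)
next
  case (Suc k)
  have fin: "finite W" using Suc.prems(1) by (simp add: forest_def)
  have "W \<noteq> {}" using Suc.hyps(2) by auto
  then obtain l where l: "l \<in> W" "forest (W - {l}) p lab rk"
      and nl: "\<And>w. w \<in> W \<Longrightarrow> lab w \<noteq> None \<Longrightarrow> p w \<noteq> l"
    using forest_leaf[OF Suc.prems(1)] by blast
  have k: "k = card (W - {l})" using Suc.hyps(2) l(1) by simp
  have val: "valid (W - {l}) p lab x" using Suc.prems(2) by (rule valid_mono) auto
  \<comment> \<open>Here \<open>k\<close> is the number of remaining vertices, so among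
    \<open>k + 1\<close> preimages one differs from all their values.\<close>
  define U' where "U' = (case lab l of None \<Rightarrow> U
    | Some n \<Rightarrow> U(p l := U (p l) \<inter> many n k (U l)))"
  have U': "loc_dense (U' w) (x w)" if "w \<in> W - {l}" for w
  proof (cases "lab l")
    case None
    then show ?thesis using Suc.prems(3) that by (simp add: U'_def)
  next
    case (Some n)
    have "x (p l) = f n (x l)" "x l \<in> D n" using Suc.prems(2) l(1) Some by (auto simp: valid_def)
    then have "loc_dense (many n k (U l)) (x (p l))"
      using loc_dense_many[OF Suc.prems(3)[OF l(1)]] by simp
    then show ?thesis using Suc.prems(3) that by (auto simp: U'_def Some intro: loc_dense_Int)
  qed
  obtain x' where x': "valid (W - {l}) p lab x'" "inj_on x' (W - {l})" "\<forall>w\<in>W - {l}. x' w \<in> U' w"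
    using Suc.hyps(1)[OF k l(2) val U'] by blast
  have sub: "x' w \<in> U w" if "w \<in> W - {l}" for w
    using x'(3) that by (auto simp: U'_def split: option.splits if_splits)
  have finF: "finite (x' ` (W - {l}))" and cardF: "card (x' ` (W - {l})) \<le> k"
    using fin k card_image_le[of "W - {l}" x'] by auto
  have "\<exists>z\<in>U l. z \<notin> x' ` (W - {l}) \<and> (\<forall>n. lab l = Some n \<longrightarrow> z \<in> D n \<and> f n z = x' (p l))"
  proof (cases "lab l")
    case None
    have "infinite (U l)" using infinite_open loc_dense_nonempty Suc.prems(3)[OF l(1)] by blast
    then have "U l - x' ` (W - {l}) \<noteq> {}" using finF by (metis finite.emptyI finite_Diff2)
    then show ?thesis using None by auto
  next
    case (Some n)
    have "p l \<in> W - {l}" using nl[OF l(1)] Some Suc.prems(1) l(1) by (auto simp: forest_def)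
    then have "x' (p l) \<in> many n k (U l)" using bspec[OF x'(3), of "p l"] Some by (simp add: U'_def)
    from many_avoid[OF this finF cardF] show ?thesis using Some by (metis option.inject)
  qed
  then obtain z where z: "z \<in> U l" "z \<notin> x' ` (W - {l})"
      "\<And>n. lab l = Some n \<Longrightarrow> z \<in> D n \<and> f n z = x' (p l)" by blast
  have "valid W p lab (x'(l := z))" by (rule valid_extend[OF x'(1) nl l(1) z(3)])
  moreover have "inj_on (x'(l := z)) W" using x'(2) z(2) by (auto simp: inj_on_def)
  moreover have "\<forall>w\<in>W. (x'(l := z)) w \<in> U w" using sub z(1) by auto
  ultimately show ?case by blast
qed

subsection \<open>Construction of the embedding\<close>

definition lab :: "(nat \<Rightarrow> nat) \<Rightarrow> nat \<Rightarrow> (nat \<Rightarrow> bool) \<Rightarrow> nat option" where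
  "lab \<phi> n \<alpha> = (if active n \<alpha> = {} then None else Some (\<phi> (Max (active n \<alpha>))))"

text \<open>Solutions are functions on the whole Cantor space, constant on classes, so that those of
  successive stages can be compared pointwise.\<close>

definition sol :: "(nat \<Rightarrow> nat) \<Rightarrow> nat \<Rightarrow> ((nat \<Rightarrow> bool) \<Rightarrow> 'a) \<Rightarrow> bool" where
  "sol \<phi> n x \<longleftrightarrow> (\<forall>\<alpha> \<beta>. rel n \<alpha> \<beta> \<longrightarrow> x \<alpha> = x \<beta>) \<and> valid UNIV (step n) (lab \<phi> n) x"

lemma sol_rel: "sol \<phi> n x \<Longrightarrow> rel n \<alpha> \<beta> \<Longrightarrow> x \<alpha> = x \<beta>"
  by (simp add: sol_def)

lemma sol_edge:
  assumes "sol \<phi> n x" "active n \<alpha> \<noteq> {}"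
  shows "x \<alpha> \<in> D (\<phi> (Max (active n \<alpha>)))" "f (\<phi> (Max (active n \<alpha>))) (x \<alpha>) = x (g (Max (active n \<alpha>)) \<alpha>)"
  using assms by (auto simp: sol_def valid_def lab_def step_def)

lemma lab_rel: "rel n \<alpha> \<beta> \<Longrightarrow> lab \<phi> n \<alpha> = lab \<phi> n \<beta>"
  using agree_active[OF rel_agree] by (simp add: lab_def)

text \<open>Representatives make the quotient a finite forest to which the perturbation lemmas
  apply; the height still drops because it depends only on the class.\<close>

lemma forest_rep: "forest (range (rep n)) (rep n \<circ> step n) (lab \<phi> n) (rank n)"
proof -
  have "rank n (rep n (step n \<alpha>)) < rank n \<alpha>" if "lab \<phi> n \<alpha> \<noteq> None" for \<alpha>
    using that rank_step[of n \<alpha>] rel_rank[OF rel_rep, of n "step n \<alpha>"]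
    by (auto simp: lab_def split: if_splits)
  then show ?thesis by (auto simp: forest_def finite_range_rep)
qed

lemma sol_imp_valid:
  assumes "sol \<phi> n x" shows "valid (range (rep n)) (rep n \<circ> step n) (lab \<phi> n) x"
  using assms sol_rel[OF assms rel_rep] by (auto simp: sol_def valid_def)

lemma valid_imp_sol:
  assumes "valid (range (rep n)) (rep n \<circ> step n) (lab \<phi> n) x" shows "sol \<phi> n (x \<circ> rep n)"
proof -
  have "lab \<phi> n (rep n \<alpha>) = lab \<phi> n \<alpha>" "rep n (step n (rep n \<alpha>)) = rep n (step n \<alpha>)" for \<alpha>
    using lab_rel[OF rel_rep] rep_eq_iff rel_step[OF rel_sym[OF rel_rep]] by auto
  then have "valid UNIV (step n) (lab \<phi> n) (x \<circ> rep n)"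
    using assms unfolding valid_def by (metis comp_apply rangeI)
  moreover have "x (rep n \<alpha>) = x (rep n \<beta>)" if "rel n \<alpha> \<beta>" for \<alpha> \<beta>
    using that by (simp flip: rep_eq_iff)
  ultimately show ?thesis by (simp add: sol_def)
qed

lemma sol_perturb_prescribed:
  assumes "sol \<phi> n x" "e > 0"
  shows "\<exists>B. open B \<and> x \<alpha> \<in> B \<and>
    (\<forall>y\<in>B. \<exists>x'. sol \<phi> n x' \<and> x' \<alpha> = y \<and> (\<forall>\<beta>. dist (x' \<beta>) (x \<beta>) < e))"
proof -
  have xr: "x (rep n \<beta>) = x \<beta>" for \<beta> using sol_rel[OF assms(1) rel_rep] by metis
  have "\<exists>B. open B \<and> x (rep n \<alpha>) \<in> B \<and>
    (\<forall>y\<in>B. \<exists>x'. valid (range (rep n)) (rep n \<circ> step n) (lab \<phi> n) x' \<and> x' (rep n \<alpha>) = y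
        \<and> (\<forall>w\<in>range (rep n). x' w \<in> ball (x w) e))"
    by (rule perturb_prescribed[OF forest_rep sol_imp_valid[OF assms(1)] rangeI]) (simp add: assms(2))
  then obtain B where B: "open B" "x \<alpha> \<in> B"
    "\<forall>y\<in>B. \<exists>x'. valid (range (rep n)) (rep n \<circ> step n) (lab \<phi> n) x' \<and> x' (rep n \<alpha>) = y
        \<and> (\<forall>w\<in>range (rep n). x' w \<in> ball (x w) e)"
    unfolding xr[of \<alpha>] by blast
  have "\<exists>x'. sol \<phi> n x' \<and> x' \<alpha> = y \<and> (\<forall>\<beta>. dist (x' \<beta>) (x \<beta>) < e)" if y: "y \<in> B" for y
  proof -
    obtain x' where x': "valid (range (rep n)) (rep n \<circ> step n) (lab \<phi> n) x'" "x' (rep n \<alpha>) = y"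
        "\<forall>w\<in>range (rep n). x' w \<in> ball (x w) e"
      using bspec[OF B(3) y] by (elim exE conjE) blast
    then show ?thesis
      by (intro exI[of _ "x' \<circ> rep n"]) (auto simp: valid_imp_sol xr dist_commute)
  qed
  then show ?thesis using B by blast
qed

lemma sol_perturb_injective:
  assumes "sol \<phi> n x" "e > 0"
  shows "\<exists>x'. sol \<phi> n x' \<and> (\<forall>\<alpha> \<beta>. x' \<alpha> = x' \<beta> \<longrightarrow> rel n \<alpha> \<beta>) \<and> (\<forall>\<beta>. dist (x' \<beta>) (x \<beta>) < e)"
proof -
  have xr: "x (rep n \<beta>) = x \<beta>" for \<beta> using sol_rel[OF assms(1) rel_rep] by metis
  obtain x' where x': "valid (range (rep n)) (rep n \<circ> step n) (lab \<phi> n) x'" "inj_on x' (range (rep n))"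
      "\<forall>w\<in>range (rep n). x' w \<in> ball (x w) e"
    using perturb_injective[OF forest_rep sol_imp_valid[OF assms(1)], of "\<lambda>w. ball (x w) e"]
      loc_dense_open[OF open_ball centre_in_ball[THEN iffD2, OF assms(2)]] by blast
  have "rel n \<alpha> \<beta>" if "x' (rep n \<alpha>) = x' (rep n \<beta>)" for \<alpha> \<beta>
    using inj_onD[OF x'(2), OF that rangeI rangeI] by (simp add: rep_eq_iff)
  then show ?thesis using x'
    by (intro exI[of _ "x' \<circ> rep n"]) (auto simp: valid_imp_sol xr dist_commute)
qed

text \<open>At a new stage, the class of \<^term>\<open>t n\<close> is split by two solutions through a point y
  and its image under a new map; vertices whose orbit meets the domain of \<^term>\<open>g n\<close> follow y.\<close>
lemma sol_Suc:
  assumes x: "sol \<phi> n x" and e: "e > 0"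
  obtains N x' where "\<forall>m<n. \<phi> m < N" "sol (\<phi>(n := N)) (Suc n) x'" "\<forall>\<beta>. dist (x' \<beta>) (x \<beta>) < e"
proof -
  define \<tau> where "\<tau> = (\<lambda>i. i < 2 ^ q n \<and> t n ! i)"
  have \<tau>: "\<tau> \<in> Nbhd (t n)" by (simp add: mem_Nbhd_t \<tau>_def)
  obtain B where B: "open B" "x \<tau> \<in> B"
    "\<forall>y\<in>B. \<exists>x'. sol \<phi> n x' \<and> x' \<tau> = y \<and> (\<forall>\<beta>. dist (x' \<beta>) (x \<beta>) < e)"
    using sol_perturb_prescribed[OF x e] by blast
  then have "B \<noteq> {}" by blast
  \<comment> \<open>Both \<open>y\<close> and \<open>f N y\<close> lie in \<open>B\<close>, so
    either can be prescribed at \<tau>. Exceeding all earlier values keeps \<phi> increasing, as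
    absorption will require.\<close>
  then obtain N y where N: "Suc (\<Sum>m<n. \<phi> m) \<le> N" "y \<in> D N" "y \<in> B" "f N y \<in> B"
    using recurrence_ge[OF B(1)] by metis
  obtain x0 where x0: "sol \<phi> n x0" "x0 \<tau> = y" "\<forall>\<beta>. dist (x0 \<beta>) (x \<beta>) < e"
    using B(3) N(3) by blast
  obtain x1 where x1: "sol \<phi> n x1" "x1 \<tau> = f N y" "\<forall>\<beta>. dist (x1 \<beta>) (x \<beta>) < e"
    using B(3) N(4) by blast
  \<comment> \<open>Edges of \<open>g n\<close> lead from the copy \<open>x0\<close> to the copy
    \<open>x1\<close>; all other forest edges stay within one copy.\<close>
  define x' where "x' = (\<lambda>\<alpha>. if hits n \<alpha> then x0 \<alpha> else x1 \<alpha>)"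
  have gt: "\<phi> m < N" if "m < n" for m
    using member_le_sum[of m "{..<n}" \<phi>] that N(1) by simp
  have inv: "x' \<alpha> = x' \<beta>" if "rel (Suc n) \<alpha> \<beta>" for \<alpha> \<beta>
    using hits_rel[OF that] sol_rel[OF x0(1) rel_Suc[OF that]] sol_rel[OF x1(1) rel_Suc[OF that]]
    by (simp add: x'_def)
  have edge: "x' \<alpha> \<in> D k \<and> f k (x' \<alpha>) = x' (step (Suc n) \<alpha>)"
    if k: "lab (\<phi>(n := N)) (Suc n) \<alpha> = Some k" for \<alpha> k
  proof (cases "\<alpha> \<in> dom_g n")
    case True
    then have "Max (active (Suc n) \<alpha>) = n" by (intro Max_eqI) (auto simp: active_def)
    then have "k = N" using k by (simp add: lab_def split: if_splits)
    have t: "\<alpha> \<in> Nbhd (t n)" using True by (simp add: mem_dom_g)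
    have "x' \<alpha> = y"
      using hits_dom_g[OF True] sol_rel[OF x0(1) rel_Nbhd_t[OF t \<tau>]] x0(2) by (simp add: x'_def)
    moreover have "x' (g n \<alpha>) = f N y"
      using not_hits_g[OF True] sol_rel[OF x1(1) rel_Nbhd_t[OF g_mem_Nbhd_t[OF t] \<tau>]] x1(2)
      by (simp add: x'_def)
    ultimately show ?thesis using N(2) True \<open>k = N\<close> by (simp add: step_Suc)
  next
    case False
    then have "active (Suc n) \<alpha> = active n \<alpha>" by (auto simp: active_def less_Suc_eq)
    moreover from this have "active n \<alpha> \<noteq> {}" using k by (auto simp: lab_def)
    moreover from this have "Max (active n \<alpha>) \<noteq> n" using Max_active(1)[of n \<alpha>] by linarith
    ultimately have "lab \<phi> n \<alpha> = Some k" using k by (simp add: lab_def)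
    then have "x0 \<alpha> \<in> D k \<and> f k (x0 \<alpha>) = x0 (step n \<alpha>)" "x1 \<alpha> \<in> D k \<and> f k (x1 \<alpha>) = x1 (step n \<alpha>)"
      using x0(1) x1(1) by (auto simp: sol_def valid_def)
    then show ?thesis using False hits_step[OF False] by (simp add: x'_def step_Suc)
  qed
  have "sol (\<phi>(n := N)) (Suc n) x'"
    using inv edge by (auto simp: sol_def valid_def)
  moreover have "\<forall>\<beta>. dist (x' \<beta>) (x \<beta>) < e" using x0(3) x1(3) by (simp add: x'_def)
  ultimately show thesis using that gt by blast
qed

text \<open>The margin \<open>e\<close> protects what is achieved: later moves will add up to at
  most \<open>e / 2\<close>, so points stay in the domains and separated classes stay apart. The
  domain clause covers every applicable index, not only the largest.\<close>

fun stage :: "nat \<Rightarrow> (nat \<Rightarrow> nat) \<times> ((nat \<Rightarrow> bool) \<Rightarrow> 'a) \<times> real \<Rightarrow> bool" where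
  "stage n (\<phi>, x, e) \<longleftrightarrow> e > 0 \<and> (\<forall>k<n. \<forall>m<k. \<phi> m < \<phi> k) \<and> sol \<phi> n x
     \<and> (\<forall>m<n. \<forall>\<alpha>\<in>dom_g m. ball (x \<alpha>) e \<subseteq> D (\<phi> m))
     \<and> (\<forall>\<alpha> \<beta>. \<not> rel n \<alpha> \<beta> \<longrightarrow> e < dist (x \<alpha>) (x \<beta>))"

text \<open>Only the edges for the largest applicable index are part of a solution; the others follow by
  absorption.\<close>
lemma stage_edge:
  assumes st: "stage n (\<phi>, x, e)" and "m < n" "\<alpha> \<in> dom_g m"
  shows "f (\<phi> m) (x \<alpha>) = x (g m \<alpha>)"
  using assms(3)
proof (induction "rank n \<alpha>" arbitrary: \<alpha> rule: less_induct)
  case less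
  define M where "M = Max (active n \<alpha>)"
  have m: "m \<in> active n \<alpha>" using less.prems assms(2) by (simp add: active_def)
  then have ne: "active n \<alpha> \<noteq> {}" by blast
  have M: "M < n" "\<alpha> \<in> dom_g M" using Max_active[OF ne] by (auto simp: M_def)
  have s: "sol \<phi> n x" and inD: "\<And>\<beta>. \<beta> \<in> dom_g m \<Longrightarrow> x \<beta> \<in> D (\<phi> m)"
    using st assms(2) by (auto simp: subset_iff)
  note edge = sol_edge[OF s ne, folded M_def]
  show ?case
  proof (cases "m = M")
    case True
    then show ?thesis using edge by simp
  next
    case False
    then have mM: "m < M" using Max_ge[OF finite_active m] by (simp add: M_def)
    have "(2::nat) ^ q m < 2 ^ q M" using strict_mono_less[OF q_strict_mono] mM by simp
    \<comment> \<open>\<open>g M\<close> keeps the digits below its pivot, and these decide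
      membership in \<open>dom_g m\<close>.\<close>
    then have "agree (2 ^ q M) (g M \<alpha>) \<alpha>" by (simp add: agree_def g_small)
    from agree_dom_g[OF this] have gd: "g M \<alpha> \<in> dom_g m"
      using less.prems \<open>(2::nat) ^ q m < 2 ^ q M\<close> by blast
    have "rank n (g M \<alpha>) < rank n \<alpha>" using rank_step[OF ne] ne by (simp add: step_def M_def)
    from less.hyps[OF this gd] have IH: "f (\<phi> m) (x (g M \<alpha>)) = x (g m (g M \<alpha>))" .
    have "\<phi> m < \<phi> M" using st mM M(1) by simp
    then have "f (\<phi> m) (f (\<phi> M) (x \<alpha>)) = f (\<phi> m) (x \<alpha>)"
      using edge inD[OF gd] inD[OF less.prems] by (intro absorb) auto
    \<comment> \<open>Passing from \<alpha> to \<open>g M \<alpha>\<close> changes neither side: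
      absorption in the space handles the left, \<open>g_absorb\<close> the right.\<close>
    then show ?thesis using edge IH g_absorb[OF mM] by simp
  qed
qed

text \<open>Two moves of size below \<open>e / 8\<close>: the first installs the edges of
  \<open>g n\<close>, the second separates all classes. The new margin is chosen last, from finitely
  many constraints.\<close>

lemma stage_Suc:
  assumes st: "stage n (\<phi>, x, e)"
  shows "\<exists>\<phi>' x' e'. stage (Suc n) (\<phi>', x', e') \<and> (\<forall>m<n. \<phi>' m = \<phi> m) \<and> e' \<le> e / 2
    \<and> (\<forall>\<alpha>. dist (x' \<alpha>) (x \<alpha>) < e / 4)"
proof -
  have e: "e / 8 > 0" and s: "sol \<phi> n x" using st by auto
  obtain N y where N: "\<forall>m<n. \<phi> m < N" "sol (\<phi>(n := N)) (Suc n) y" "\<forall>\<beta>. dist (y \<beta>) (x \<beta>) < e / 8"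
    using sol_Suc[OF s e] .
  define \<phi>' where "\<phi>' = \<phi>(n := N)"
  obtain x' where x': "sol \<phi>' (Suc n) x'" "\<forall>\<alpha> \<beta>. x' \<alpha> = x' \<beta> \<longrightarrow> rel (Suc n) \<alpha> \<beta>"
      "\<forall>\<beta>. dist (x' \<beta>) (y \<beta>) < e / 8"
    using sol_perturb_injective[OF N(2) e] unfolding \<phi>'_def by blast
  have close: "dist (x' \<alpha>) (x \<alpha>) < e / 4" for \<alpha>
    using spec[OF x'(3), of \<alpha>] spec[OF N(3), of \<alpha>] dist_triangle[of "x' \<alpha>" "x \<alpha>" "y \<alpha>"]
    by linarith
  have inD: "x' \<alpha> \<in> D (\<phi>' m)" if m: "m < Suc n" "\<alpha> \<in> dom_g m" for m \<alpha>
  proof (cases "m = n")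
    case True
    then have "active (Suc n) \<alpha> \<noteq> {}" "Max (active (Suc n) \<alpha>) = n"
      using m by (auto simp: active_def intro!: Max_eqI)
    then show ?thesis using sol_edge(1)[OF x'(1)] True by metis
  next
    case False
    then have "ball (x \<alpha>) e \<subseteq> D (\<phi> m)" using st m by auto
    moreover have "x' \<alpha> \<in> ball (x \<alpha>) e" using close[of \<alpha>] e by (simp add: dist_commute)
    ultimately show ?thesis using False by (auto simp: \<phi>'_def)
  qed
  let ?R = "range (rep (Suc n))"
  have fin: "finite ?R" by (rule finite_range_rep)
  have xr: "x' (rep (Suc n) \<alpha>) = x' \<alpha>" for \<alpha> using sol_rel[OF x'(1) rel_rep] by metis
  \<comment> \<open>Each constraint holds for all sufficiently small positive \<open>d\<close>; the
    filter combines the finitely many of them.\<close>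
  have less: "\<forall>\<^sub>F d in at_right 0. d < c" if "c > 0" for c :: real
    using that by (auto simp: eventually_at_right_field)
  have "\<forall>\<^sub>F d in at_right 0. \<forall>w\<in>?R. \<forall>m\<in>{..<Suc n}. w \<in> dom_g m \<longrightarrow> ball (x' w) d \<subseteq> D (\<phi>' m)"
  proof (intro eventually_ball_finite fin ballI finite_lessThan)
    fix w m assume m: "m \<in> {..<Suc n}"
    show "\<forall>\<^sub>F d in at_right 0. w \<in> dom_g m \<longrightarrow> ball (x' w) d \<subseteq> D (\<phi>' m)"
    proof (cases "w \<in> dom_g m")
      case True
      then have "x' w \<in> D (\<phi>' m)" using inD m by simp
      then obtain c where "c > 0" "ball (x' w) c \<subseteq> D (\<phi>' m)" using open_D openE by metis
      then show ?thesis using less[of c] by (auto elim!: eventually_mono)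
    qed simp
  qed
  moreover have "\<forall>\<^sub>F d in at_right 0. \<forall>w\<in>?R. \<forall>v\<in>?R. \<not> rel (Suc n) w v \<longrightarrow> d < dist (x' w) (x' v)"
  proof (intro eventually_ball_finite fin ballI)
    fix w v
    show "\<forall>\<^sub>F d in at_right 0. \<not> rel (Suc n) w v \<longrightarrow> d < dist (x' w) (x' v)"
      using x'(2) less[of "dist (x' w) (x' v)"] by (cases "rel (Suc n) w v") auto
  qed
  moreover have "\<forall>\<^sub>F d in at_right 0. d < e / 2" using e by (intro less) simp
  moreover have "\<forall>\<^sub>F d in at_right (0::real). d > 0" by (rule eventually_at_right_less)
  ultimately have "\<forall>\<^sub>F d in at_right 0. d > 0 \<and> d < e / 2
      \<and> (\<forall>w\<in>?R. \<forall>m\<in>{..<Suc n}. w \<in> dom_g m \<longrightarrow> ball (x' w) d \<subseteq> D (\<phi>' m))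
      \<and> (\<forall>w\<in>?R. \<forall>v\<in>?R. \<not> rel (Suc n) w v \<longrightarrow> d < dist (x' w) (x' v))"
    by eventually_elim blast
  then obtain d where d: "d > 0" "d < e / 2"
      "\<forall>w\<in>?R. \<forall>m\<in>{..<Suc n}. w \<in> dom_g m \<longrightarrow> ball (x' w) d \<subseteq> D (\<phi>' m)"
      "\<forall>w\<in>?R. \<forall>v\<in>?R. \<not> rel (Suc n) w v \<longrightarrow> d < dist (x' w) (x' v)"
    using eventually_happens'[OF trivial_limit_at_right_real] by blast
  have "ball (x' \<alpha>) d \<subseteq> D (\<phi>' m)" if "m < Suc n" "\<alpha> \<in> dom_g m" for m \<alpha>
    using d(3) that rel_dom_g[OF rel_rep that(1), of \<alpha>] xr[of \<alpha>] by (metis lessThan_iff rangeI)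
  moreover have "d < dist (x' \<alpha>) (x' \<beta>)" if "\<not> rel (Suc n) \<alpha> \<beta>" for \<alpha> \<beta>
  proof -
    have "\<not> rel (Suc n) (rep (Suc n) \<alpha>) (rep (Suc n) \<beta>)"
      using that rel_rep rel_sym rel_trans by metis
    then show ?thesis using d(4) xr by (metis rangeI)
  qed
  moreover have "\<forall>k<Suc n. \<forall>m<k. \<phi>' m < \<phi>' k"
    using st N(1) by (auto simp: \<phi>'_def less_Suc_eq)
  ultimately have "stage (Suc n) (\<phi>', x', d)" using x'(1) d(1) by simp
  moreover have "\<forall>m<n. \<phi>' m = \<phi> m" by (simp add: \<phi>'_def)
  ultimately show ?thesis using d(2) close by (meson less_imp_le)
qed

text \<open>Since \<open>q 0 = 0\<close>, all sequences are related: one vertex and no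
  edges.\<close>

lemma stage_0: "stage 0 (\<lambda>_. 0, \<lambda>_. undefined, 1)"
  by (simp add: sol_def valid_def lab_def active_def rel_def agree_def)

lemma stages:
  obtains \<phi> x e where "\<And>n. stage n (\<phi>, x n, e n)" "\<And>n. e (Suc n) \<le> e n / 2"
    "\<And>n \<alpha>. dist (x (Suc n) \<alpha>) (x n \<alpha>) < e n / 4"
proof -
  have "\<exists>s. \<forall>n. stage n (s n) \<and> ((\<forall>m<n. fst (s (Suc n)) m = fst (s n) m)
      \<and> snd (snd (s (Suc n))) \<le> snd (snd (s n)) / 2
      \<and> (\<forall>\<alpha>. dist (fst (snd (s (Suc n))) \<alpha>) (fst (snd (s n)) \<alpha>) < snd (snd (s n)) / 4))"
  proof (rule dependent_nat_choice)
    show "\<exists>s. stage 0 s" using stage_0 by blast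
  next
    fix s n assume "stage n s"
    then show "\<exists>s'. stage (Suc n) s' \<and> (\<forall>m<n. fst s' m = fst s m)
        \<and> snd (snd s') \<le> snd (snd s) / 2 \<and> (\<forall>\<alpha>. dist (fst (snd s') \<alpha>) (fst (snd s) \<alpha>) < snd (snd s) / 4)"
      using stage_Suc[of n "fst s" "fst (snd s)" "snd (snd s)"] by auto
  qed
  then obtain s where s: "\<And>n. stage n (s n)" "\<And>n m. m < n \<Longrightarrow> fst (s (Suc n)) m = fst (s n) m"
      "\<And>n. snd (snd (s (Suc n))) \<le> snd (snd (s n)) / 2"
      "\<And>n \<alpha>. dist (fst (snd (s (Suc n))) \<alpha>) (fst (snd (s n)) \<alpha>) < snd (snd (s n)) / 4"
    by blast
  \<comment> \<open>The value at \<open>m\<close> is frozen from stage \<open>Suc m\<close> on, and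
    stage \<open>n\<close> consults \<phi> only below \<open>n\<close>, so one sequence serves all
    stages.\<close>
  define \<phi> where "\<phi> m = fst (s (Suc m)) m" for m
  have \<phi>: "fst (s n) m = \<phi> m" if "m < n" for m n
    using that
  proof (induction n)
    case (Suc n)
    then show ?case by (cases "m = n") (auto simp: \<phi>_def s(2))
  qed simp
  have "stage n (\<phi>, fst (snd (s n)), snd (snd (s n)))" for n
  proof -
    obtain \<psi> y d where sn: "s n = (\<psi>, y, d)" by (metis surj_pair)
    have \<psi>: "\<psi> m = \<phi> m" if "m < n" for m using \<phi>[OF that] sn by simp
    then have "lab \<psi> n = lab \<phi> n"
      using Max_active(1) by (auto simp: lab_def fun_eq_iff)
    moreover have "stage n (\<psi>, y, d)" using s(1)[of n] sn by simp
    ultimately show ?thesis using \<psi> sn by (simp add: sol_def)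
  qed
  then show thesis using that[of \<phi> "\<lambda>n. fst (snd (s n))" "\<lambda>n. snd (snd (s n))"] s by blast
qed

section \<open>The limit map\<close>

lemma isCont_f: "x \<in> D n \<Longrightarrow> isCont (f n) x"
  using situation open_D continuous_on_eq_continuous_at by (auto simp: complex_situation_def)

lemma openin_cantor_agree: "openin cantor_top {\<beta>. agree L \<alpha> \<beta>}"
proof -
  have "openin cantor_top (PiE UNIV (\<lambda>k. if k < L then {\<alpha> k} else UNIV))"
    unfolding cantor_top_def
    by (subst openin_PiE_gen) (auto intro: finite_subset[of _ "{..<L}"] split: if_splits)
  moreover have "PiE UNIV (\<lambda>k. if k < L then {\<alpha> k} else UNIV) = {\<beta>. agree L \<alpha> \<beta>}"
    by (auto simp: agree_def PiE_def Pi_def split: if_splits)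
  ultimately show ?thesis by simp
qed

theorem embedding:
  "\<exists>h. continuous_map cantor_top euclidean h \<and> inj h \<and> G1 \<subseteq> (\<lambda>(x, y). (h x, h y)) -` Af D f"
proof -
  obtain \<phi> x e where st: "\<And>n. stage n (\<phi>, x n, e n)" and half: "\<And>n. e (Suc n) \<le> e n / 2"
      and close: "\<And>n \<alpha>. dist (x (Suc n) \<alpha>) (x n \<alpha>) < e n / 4"
    by (rule stages) (rule that, assumption+)
  have e: "e n > 0" for n using st[of n] by simp
  \<comment> \<open>Telescoping: a move below \<open>e n / 4\<close> is at most the drop from
    \<open>e n / 2\<close> to \<open>e (Suc n) / 2\<close>.\<close>
  have dist_add: "dist (x (n + k) \<alpha>) (x n \<alpha>) \<le> e n / 2 - e (n + k) / 2" for n k \<alpha>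
  proof (induction k)
    case (Suc k)
    then show ?case
      using close[of "n + k" \<alpha>] half[of "n + k"]
        dist_triangle[of "x (n + Suc k) \<alpha>" "x n \<alpha>" "x (n + k) \<alpha>"] by simp
  qed simp
  have e_le: "e n \<le> e 0 * (1 / 2) ^ n" for n
  proof (induction n)
    case (Suc n)
    then show ?case using half[of n] by simp
  qed simp
  have lim_e: "e \<longlonglongrightarrow> 0"
  proof (rule tendsto_sandwich[where f="\<lambda>_. 0"])
    show "(\<lambda>n. e 0 * (1 / 2) ^ n) \<longlonglongrightarrow> 0"
      by (intro tendsto_mult_right_zero LIMSEQ_power_zero) simp
  qed (use e e_le less_imp_le in \<open>auto intro!: always_eventually\<close>)
  have "Cauchy (\<lambda>n. x n \<alpha>)" for \<alpha>
  proof (rule metric_CauchyI)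
    fix d :: real assume "d > 0"
    then obtain n where n: "e n < d"
        using eventually_happens'[OF sequentially_bot order_tendstoD(2)[OF lim_e]] by blast
    have near: "dist (x k \<alpha>) (x n \<alpha>) < d / 2" if "n \<le> k" for k
      using dist_add[of n "k - n" \<alpha>] that n e[of k] by simp
    have "dist (x k \<alpha>) (x l \<alpha>) < d" if "n \<le> k" "n \<le> l" for k l
      using near[OF that(1)] near[OF that(2)] by (rule dist_triangle_half_l)
    then show "\<exists>M. \<forall>k\<ge>M. \<forall>l\<ge>M. dist (x k \<alpha>) (x l \<alpha>) < d" by blast
  qed
  then have "convergent (\<lambda>n. x n \<alpha>)" for \<alpha> by (rule Cauchy_convergent)
  define h where "h \<alpha> = lim (\<lambda>n. x n \<alpha>)" for \<alpha>
  have h: "(\<lambda>n. x n \<alpha>) \<longlonglongrightarrow> h \<alpha>" for \<alpha>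
    using \<open>convergent (\<lambda>n. x n \<alpha>)\<close> by (simp add: h_def convergent_LIMSEQ_iff)
  have dist_h: "dist (h \<alpha>) (x n \<alpha>) \<le> e n / 2" for n \<alpha>
  proof (rule LIMSEQ_le_const2)
    show "(\<lambda>k. dist (x (k + n) \<alpha>) (x n \<alpha>)) \<longlonglongrightarrow> dist (h \<alpha>) (x n \<alpha>)"
      by (intro tendsto_dist tendsto_const LIMSEQ_ignore_initial_segment h)
    have "dist (x (k + n) \<alpha>) (x n \<alpha>) \<le> e n / 2" for k
      using dist_add[of n k \<alpha>] e[of "n + k"] by (simp add: add.commute)
    then show "\<exists>N. \<forall>k\<ge>N. dist (x (k + n) \<alpha>) (x n \<alpha>) \<le> e n / 2" by blast
  qed
  have "continuous_map cantor_top euclidean h"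
    unfolding continuous_map_def
  proof (intro conjI allI impI)
    show "h \<in> topspace cantor_top \<rightarrow> topspace euclidean" by (simp add: Pi_def)
  next
    fix U :: "'a set" assume "openin euclidean U"
    then have U: "open U" by simp
    show "openin cantor_top {\<alpha> \<in> topspace cantor_top. h \<alpha> \<in> U}"
    proof (subst openin_subopen, intro ballI)
      fix \<alpha> assume "\<alpha> \<in> {\<alpha> \<in> topspace cantor_top. h \<alpha> \<in> U}"
      then have "h \<alpha> \<in> U" by simp
      with U obtain d where d: "d > 0" "ball (h \<alpha>) d \<subseteq> U" by (rule openE)
      then obtain n where n: "e n < d"
        using eventually_happens'[OF sequentially_bot order_tendstoD(2)[OF lim_e]] by blast
      \<comment> \<open>\<open>x n\<close> is constant on this cylinder, and \<open>h\<close> stays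
        within \<open>e n / 2\<close> of it.\<close>
      have "h \<beta> \<in> U" if "agree (2 ^ q n) \<alpha> \<beta>" for \<beta>
      proof -
        have "sol \<phi> n (x n)" using st[of n] by simp
        from sol_rel[OF this agree_imp_rel[OF that]] have "x n \<alpha> = x n \<beta>" .
        then have "dist (h \<alpha>) (h \<beta>) \<le> e n"
          using dist_h[of \<alpha> n] dist_h[of \<beta> n] dist_triangle2[of "h \<alpha>" "h \<beta>" "x n \<alpha>"] by simp
        then show ?thesis using n d(2) by (auto simp: subset_iff)
      qed
      then show "\<exists>T. openin cantor_top T \<and> \<alpha> \<in> T \<and> T \<subseteq> {\<alpha> \<in> topspace cantor_top. h \<alpha> \<in> U}"
        by (intro exI[of _ "{\<beta>. agree (2 ^ q n) \<alpha> \<beta>}"])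
          (auto simp: openin_cantor_agree, auto simp: agree_def cantor_top_def)
    qed
  qed
  moreover have "inj h"
  proof (rule injI, rule ccontr)
    fix \<alpha> \<beta> assume eq: "h \<alpha> = h \<beta>" and "\<alpha> \<noteq> \<beta>"
    obtain i where i: "\<alpha> i \<noteq> \<beta> i" using \<open>\<alpha> \<noteq> \<beta>\<close> by (auto simp: fun_eq_iff)
    have "i < q (Suc i)" using le_q[of "Suc i"] by simp
    then have "\<not> rel (Suc i) \<alpha> \<beta>" using i rel_agree unfolding agree_def by blast
    \<comment> \<open>The separation strictly exceeds the margin, while each of the two points
      drifts by at most half of it.\<close>
    then have "e (Suc i) < dist (x (Suc i) \<alpha>) (x (Suc i) \<beta>)" using st[of "Suc i"] by simp
    then show False
      using dist_h[of \<alpha> "Suc i"] dist_h[of \<beta> "Suc i"] eq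
        dist_triangle3[of "x (Suc i) \<alpha>" "x (Suc i) \<beta>" "h \<alpha>"] by simp
  qed
  moreover have "(h \<alpha>, h (g m \<alpha>)) \<in> Af D f" if \<alpha>: "\<alpha> \<in> dom_g m" for \<alpha> m
  proof -
    \<comment> \<open>A limit could leave the open domain; a drift of at most half the margin
      prevents this.\<close>
    have "ball (x (Suc m) \<alpha>) (e (Suc m)) \<subseteq> D (\<phi> m)" using st[of "Suc m"] \<alpha> by simp
    moreover have "h \<alpha> \<in> ball (x (Suc m) \<alpha>) (e (Suc m))"
      using dist_h[of \<alpha> "Suc m"] e[of "Suc m"] by (simp add: dist_commute)
    ultimately have hD: "h \<alpha> \<in> D (\<phi> m)" by blast
    have "(\<lambda>n. f (\<phi> m) (x n \<alpha>)) \<longlonglongrightarrow> f (\<phi> m) (h \<alpha>)"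
      by (rule isCont_tendsto_compose[OF isCont_f[OF hD] h])
    moreover have "\<forall>\<^sub>F n in sequentially. f (\<phi> m) (x n \<alpha>) = x n (g m \<alpha>)"
      using eventually_gt_at_top[of m] by eventually_elim (rule stage_edge[OF st _ \<alpha>])
    ultimately have "(\<lambda>n. x n (g m \<alpha>)) \<longlonglongrightarrow> f (\<phi> m) (h \<alpha>)"
      by (rule Lim_transform_eventually)
    then have "h (g m \<alpha>) = f (\<phi> m) (h \<alpha>)" using h LIMSEQ_unique by blast
    then show ?thesis using hD by (auto simp: Af_def graph_of_def)
  qed
  then have "G1 \<subseteq> (\<lambda>(x, y). (h x, h y)) -` Af D f"
    by (auto simp: G1_def graph_of_def dom_g_def)
  ultimately show ?thesis by blast
qed

end

theorem theorem1p8: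
  fixes D :: "nat \<Rightarrow> 'a::polish_space set" and f :: "nat \<Rightarrow> 'a \<Rightarrow> 'a"
  assumes "complex_situation D f"
    and "\<And>m n x. m < n \<Longrightarrow> x \<in> D n \<Longrightarrow> f n x \<in> D m \<Longrightarrow> x \<in> D m
           \<Longrightarrow> f m (f n x) = f m x"
  shows "\<exists>h :: (nat \<Rightarrow> bool) \<Rightarrow> 'a. continuous_map cantor_top euclidean h \<and> inj h
           \<and> G1 \<subseteq> (\<lambda>(x, y). (h x, h y)) -` Af D f"
proof -
  interpret absorbing_situation D f using assms by unfold_locales
  show ?thesis by (rule embedding)
qed

end
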